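(* The infinite Johnson graph $J(\infty,2)$ has no quantum symmetry.
   Context: Graphs are undirected, simple and without loops: a graph $X=(V_X,E_X)$ is a set $V_X$ with $E_X\subset V_X\times V_X$ symmetric and $(v,v)\notin E_X$ for all $v$. The graph $J(\infty,2)$ has as vertices all $2$-element subsets of $\mathbb N$, two vertices being connected by an edge iff their intersection contains exactly one element. For vertices $v,w$ let $\mathrm{rel}(v,w)\in\{\text{equal},\text{adjacent},\text{distinct and non-adjacent}\}$ denote their adjacency relation. A quantum automorphism of a graph $X$ is a pair $\sigma=(\mathcal H,u)$ of a Hilbert space and a family $u=(u_{xy})_{x,y\in V_X}$ of projections in $B(\mathcal H)$ such that each row and each column consists of pairwise orthogonal projections summing to $1$ in the strong operator topology, and such that $u_{x_1y_1}u_{x_2y_2}=0$ whenever $\mathrm{rel}(x_1,x_2)\neq\mathrm{rel}(y_1,y_2)$. It is irreducible if the only bounded operators on $\mathcal H$ commuting with all $u_{xy}$ are scalar multiples of the identity; its dimension is $\dim\mathcal H$. A graph has no quantum symmetry if every irreducible quantum automorphism of it is one-dimensional; otherwise it has quantum symmetry. *)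

theory Defs
  imports "HOL-Analysis.Analysis"
begin

subsection \<open>Complex Hilbert spaces\<close>

text \<open>
  A complex Hilbert space is presented on top of its underlying real Hilbert space, so that norm,
  topology, completeness and infinite sums are the ones of the library. The inner product is
  conjugate linear in the first argument. Positive definiteness follows from
  \<open>inner_eq_Re_cinner\<close>, as the real inner product is positive definite.
\<close>

class complex_hilbert_space = real_inner + complete_space +
  fixes scaleC :: "complex \<Rightarrow> 'a \<Rightarrow> 'a" (infixr "*\<^sub>C" 75)
    and cinner :: "'a \<Rightarrow> 'a \<Rightarrow> complex"
  assumes scaleC_add_right: "a *\<^sub>C (x + y) = a *\<^sub>C x + a *\<^sub>C y"
    and scaleC_add_left: "(a + b) *\<^sub>C x = a *\<^sub>C x + b *\<^sub>C x"
    and scaleC_scaleC: "a *\<^sub>C (b *\<^sub>C x) = (a * b) *\<^sub>C x"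
    and scaleR_scaleC: "scaleR r x = complex_of_real r *\<^sub>C x"
    and cinner_commute: "cinner x y = cnj (cinner y x)"
    and cinner_add_left: "cinner (x + y) z = cinner x z + cinner y z"
    and cinner_scaleC_left: "cinner (a *\<^sub>C x) y = cnj a * cinner x y"
    and inner_eq_Re_cinner: "inner x y = Re (cinner x y)"

lemma cinner_self_eq_norm:
  fixes x :: "'a::complex_hilbert_space"
  shows "cinner x x = complex_of_real ((norm x)\<^sup>2)"
proof (rule complex_eqI)
  show "Re (cinner x x) = Re (complex_of_real ((norm x)\<^sup>2))"
    by (simp add: inner_eq_Re_cinner[symmetric] power2_norm_eq_inner)
  have "Im (cinner x x) = - Im (cinner x x)"
    by (metis cinner_commute cnj.simps(2))
  then show "Im (cinner x x) = Im (complex_of_real ((norm x)\<^sup>2))"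
    by simp
qed

global_interpretation complex_vector: vector_space
  "scaleC :: complex \<Rightarrow> 'a \<Rightarrow> 'a::complex_hilbert_space"
  defines cdim = complex_vector.dim
proof
  fix x :: 'a
  show "1 *\<^sub>C x = x"
    using scaleR_scaleC[of 1 x] by simp
qed (simp_all add: scaleC_add_right scaleC_add_left scaleC_scaleC)

instantiation complex :: complex_hilbert_space
begin

definition scaleC_complex :: "complex \<Rightarrow> complex \<Rightarrow> complex"
  where "scaleC_complex a x = a * x"

definition cinner_complex :: "complex \<Rightarrow> complex \<Rightarrow> complex"
  where "cinner_complex x y = cnj x * y"

instance
  by standard
    (simp_all add: scaleC_complex_def cinner_complex_def algebra_simps scaleR_conv_of_real
      inner_complex_def)

end

instantiation vec :: (complex_hilbert_space, finite) complex_hilbert_space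
begin

definition scaleC_vec :: "complex \<Rightarrow> 'a ^ 'b \<Rightarrow> 'a ^ 'b"
  where "scaleC_vec a x = (\<chi> i. a *\<^sub>C (x $ i))"

definition cinner_vec :: "'a ^ 'b \<Rightarrow> 'a ^ 'b \<Rightarrow> complex"
  where "cinner_vec x y = (\<Sum>i\<in>UNIV. cinner (x $ i) (y $ i))"

instance
proof
  fix x y :: "'a ^ 'b"
  show "cinner x y = cnj (cinner y x)"
    unfolding cinner_vec_def cnj_sum by (rule sum.cong[OF refl], rule cinner_commute)
qed (simp_all add: scaleC_vec_def cinner_vec_def vec_eq_iff scaleC_add_right scaleC_add_left
      scaleC_scaleC scaleR_scaleC cinner_add_left cinner_scaleC_left sum.distrib sum_distrib_left
      inner_vec_def inner_eq_Re_cinner)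

end

definition bounded_clinear :: "('h::complex_hilbert_space \<Rightarrow> 'h) \<Rightarrow> bool"
  where "bounded_clinear T \<longleftrightarrow> bounded_linear T \<and> (\<forall>c \<xi>. T (c *\<^sub>C \<xi>) = c *\<^sub>C T \<xi>)"

definition is_projection :: "('h::complex_hilbert_space \<Rightarrow> 'h) \<Rightarrow> bool"
  where "is_projection p \<longleftrightarrow> bounded_clinear p \<and> p \<circ> p = p \<and>
    (\<forall>\<xi> \<eta>. cinner (p \<xi>) \<eta> = cinner \<xi> (p \<eta>))"

text \<open>
  Pointwise \<open>has_sum\<close> is convergence, in the strong operator topology, of the net of sums over
  finite subsets of the index set.
\<close>

definition projections_sum_to_one ::
    "('i \<Rightarrow> 'h \<Rightarrow> 'h::complex_hilbert_space) \<Rightarrow> 'i set \<Rightarrow> bool"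
  where "projections_sum_to_one p I \<longleftrightarrow>
    (\<forall>i\<in>I. is_projection (p i)) \<and>
    (\<forall>i\<in>I. \<forall>j\<in>I. i \<noteq> j \<longrightarrow> p i \<circ> p j = (\<lambda>_. 0)) \<and>
    (\<forall>\<xi>. ((\<lambda>i. p i \<xi>) has_sum \<xi>) I)"


subsection \<open>Graphs and their quantum automorphisms\<close>

definition is_graph :: "'v set \<Rightarrow> ('v \<times> 'v) set \<Rightarrow> bool"
  where "is_graph V E \<longleftrightarrow> E \<subseteq> V \<times> V \<and> sym E \<and> (\<forall>v. (v, v) \<notin> E)"

datatype adjacency = Equal_vertices | Adjacent_vertices | Nonadjacent_vertices

definition rel :: "('v \<times> 'v) set \<Rightarrow> 'v \<Rightarrow> 'v \<Rightarrow> adjacency"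
  where "rel E v w =
    (if v = w then Equal_vertices
     else if (v, w) \<in> E then Adjacent_vertices
     else Nonadjacent_vertices)"

definition quantum_automorphism ::
    "'v set \<Rightarrow> ('v \<times> 'v) set \<Rightarrow> ('v \<Rightarrow> 'v \<Rightarrow> 'h \<Rightarrow> 'h::complex_hilbert_space) \<Rightarrow> bool"
  where "quantum_automorphism V E u \<longleftrightarrow>
    (\<forall>x\<in>V. projections_sum_to_one (\<lambda>y. u x y) V) \<and>
    (\<forall>y\<in>V. projections_sum_to_one (\<lambda>x. u x y) V) \<and>
    (\<forall>x\<^sub>1\<in>V. \<forall>x\<^sub>2\<in>V. \<forall>y\<^sub>1\<in>V. \<forall>y\<^sub>2\<in>V.
      rel E x\<^sub>1 x\<^sub>2 \<noteq> rel E y\<^sub>1 y\<^sub>2 \<longrightarrow> u x\<^sub>1 y\<^sub>1 \<circ> u x\<^sub>2 y\<^sub>2 = (\<lambda>_. 0))"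

text \<open>
  As usual, the zero representation does not count as irreducible: on the zero space, the zero
  family is a (zero-dimensional) quantum automorphism of every graph.
\<close>

definition irreducible_family ::
    "'v set \<Rightarrow> ('v \<Rightarrow> 'v \<Rightarrow> 'h \<Rightarrow> 'h::complex_hilbert_space) \<Rightarrow> bool"
  where "irreducible_family V u \<longleftrightarrow>
    (\<exists>\<xi>::'h. \<xi> \<noteq> 0) \<and>
    (\<forall>T. bounded_clinear T \<and> (\<forall>x\<in>V. \<forall>y\<in>V. T \<circ> u x y = u x y \<circ> T) \<longrightarrow>
      (\<exists>c. T = (\<lambda>\<xi>. c *\<^sub>C \<xi>)))"

text \<open>
  The Hilbert space is represented by a type; a statement about \<open>TYPE('h)\<close> with \<open>'h\<close> a type
  variable thus speaks about all Hilbert spaces. Since \<open>cdim\<close> is \<open>0\<close> on spaces of infinite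
  dimension, \<open>cdim UNIV = 1\<close> does mean that the space is one-dimensional.
\<close>

definition no_quantum_symmetry ::
    "'h::complex_hilbert_space itself \<Rightarrow> 'v set \<Rightarrow> ('v \<times> 'v) set \<Rightarrow> bool"
  where "no_quantum_symmetry _ V E \<longleftrightarrow>
    (\<forall>u :: 'v \<Rightarrow> 'v \<Rightarrow> 'h \<Rightarrow> 'h.
      quantum_automorphism V E u \<and> irreducible_family V u \<longrightarrow> cdim (UNIV :: 'h set) = 1)"


subsection \<open>The infinite Johnson graph\<close>

definition J_vertices :: "nat set set"
  where "J_vertices = {A. card A = 2}"

definition J_edges :: "(nat set \<times> nat set) set"
  where "J_edges = {(A, B). A \<in> J_vertices \<and> B \<in> J_vertices \<and> card (A \<inter> B) = 1}"

lemma is_graph_J: "is_graph J_vertices J_edges"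
  by (auto simp: is_graph_def J_edges_def J_vertices_def sym_def Int_commute)

end

theory Submission
  imports Defs
begin

text \<open>
  Classically, an automorphism of the line graph of the complete graph on \<open>\<nat>\<close> comes from a
  permutation of \<open>\<nat>\<close>. For a quantum automorphism \<open>u\<close>, let \<open>P a f\<close> be the sum of \<open>u e f\<close> over all
  edges \<open>e\<close> through \<open>a\<close>. For a unit vector in the range of \<open>P a {b, c}\<close>, counting, in column \<open>{i, j}\<close>, the edges
  through \<open>a\<close> adjacent to a given edge shows that the squared norms of the components under
  \<open>P a {b, i}\<close>, \<open>P a {b, j}\<close>, \<open>P a {c, i}\<close>, \<open>P a {c, j}\<close> add up to \<open>2\<close>. As
  \<open>P a {b, i}\<close> and \<open>P a {c, j}\<close> are orthogonal, this forces
  \<open>P a {b, c} = C a b + C a c\<close>, where \<open>C a b\<close> is the product of any two distinct \<open>P a {b, i}\<close> and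
  \<open>P a {b, j}\<close>. Hence \<open>C\<close> is a quantum permutation with
  \<open>u {a, a'} {b, b'} = C a b C a' b' + C a b' C a' b\<close>. The left-hand side is symmetric in \<open>a\<close> and
  \<open>a'\<close>, which makes the entries of \<open>C\<close>, and therefore those of \<open>u\<close>, commute.
\<close>

subsection \<open>Orthogonal projections\<close>

text \<open>Stated over the reals: commutation of the entries \<open>u e f\<close> needs no complex
  scalars, which return only for the scalar commutant.\<close>

definition orth_proj :: "('h::real_inner \<Rightarrow> 'h) \<Rightarrow> bool"
  where "orth_proj p \<longleftrightarrow> bounded_linear p \<and> (\<forall>x. p (p x) = p x) \<and>
    (\<forall>x y. inner (p x) y = inner x (p y))"

lemma orth_projD:
  assumes "orth_proj p"
  shows orth_proj_bounded_linear: "bounded_linear p"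
    and orth_proj_idem: "p (p x) = p x"
    and orth_proj_selfadjoint: "inner (p x) y = inner x (p y)"
    and orth_proj_add: "p (x + y) = p x + p y"
    and orth_proj_zero: "p 0 = 0"
    and orth_proj_norm_sq: "(norm (p x))\<^sup>2 = inner x (p x)"
  using assms unfolding orth_proj_def power2_norm_eq_inner
  by (auto simp: linear_simps)

lemma orth_proj_norm_le:
  assumes "orth_proj p"
  shows "norm (p x) \<le> norm x"
proof -
  have "(norm (p x))\<^sup>2 \<le> norm x * norm (p x)"
    unfolding orth_proj_norm_sq[OF assms] by (rule norm_cauchy_schwarz)
  then show ?thesis
    by (cases "p x = 0") (auto simp: power2_eq_square)
qed

text \<open>The hypothesis reads pq = qpq. Since qpq is self-adjoint, pq equals its adjoint
  qp.\<close>

lemma orth_proj_commute: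
  assumes p: "orth_proj p" and q: "orth_proj q" and qpq: "\<And>x. p (q x) = q (p (q x))"
  shows "p (q x) = q (p x)"
proof (rule vector_eq_rdot[THEN iffD1, OF allI])
  fix y
  have "inner (q (p x)) y = inner x (p (q y))"
    by (simp only: orth_proj_selfadjoint[OF p] orth_proj_selfadjoint[OF q])
  also have "\<dots> = inner x (q (p (q y)))"
    by (subst qpq) (rule refl)
  also have "\<dots> = inner (q (p (q x))) y"
    by (simp only: orth_proj_selfadjoint[OF p] orth_proj_selfadjoint[OF q])
  finally show "inner (p (q x)) y = inner (q (p x)) y"
    by (subst qpq) (rule sym)
qed

section \<open>Resolutions of the identity and their partial sums\<close>

definition orth_resolution :: "('i \<Rightarrow> 'h \<Rightarrow> 'h::real_inner) \<Rightarrow> 'i set \<Rightarrow> bool"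
  where "orth_resolution p I \<longleftrightarrow> (\<forall>i\<in>I. orth_proj (p i)) \<and>
    (\<forall>i\<in>I. \<forall>j\<in>I. i \<noteq> j \<longrightarrow> (\<forall>x. p i (p j x) = 0)) \<and>
    (\<forall>x. ((\<lambda>i. p i x) has_sum x) I)"

text \<open>For \<open>S\<close> inside the index set of a resolution the default value 0 of a
  divergent sum never enters: in a complete space summability passes to subsets.\<close>

definition partial_resolution :: "('i \<Rightarrow> 'h \<Rightarrow> 'h) \<Rightarrow> 'i set \<Rightarrow> 'h \<Rightarrow> 'h::real_inner"
  where "partial_resolution p S x = (\<Sum>\<^sub>\<infinity>i\<in>S. p i x)"

context
  fixes p :: "'i \<Rightarrow> 'h \<Rightarrow> 'h::{real_inner,banach}" and I S :: "'i set"
  assumes res: "orth_resolution p I" and sub: "S \<subseteq> I"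
begin

lemma orth_resolution_proj: "i \<in> I \<Longrightarrow> orth_proj (p i)"
  and orth_resolution_orth: "i \<in> I \<Longrightarrow> j \<in> I \<Longrightarrow> i \<noteq> j \<Longrightarrow> p i (p j x) = 0"
  and orth_resolution_has_sum: "((\<lambda>i. p i x) has_sum x) I"
  using res unfolding orth_resolution_def by blast+

lemma partial_resolution_has_sum:
  "((\<lambda>i. p i x) has_sum partial_resolution p S x) S"
  unfolding partial_resolution_def
  by (rule has_sum_infsum[OF summable_on_subset_banach[OF
          has_sum_imp_summable[OF orth_resolution_has_sum] sub]])

lemma partial_resolution_bounded_linear_has_sum:
  "bounded_linear T \<Longrightarrow> ((\<lambda>i. T (p i x)) has_sum T (partial_resolution p S x)) S"
  by (rule has_sum_bounded_linear[OF _ partial_resolution_has_sum])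

lemma partial_resolution_eq_zero:
  assumes "bounded_linear T" "\<And>i. i \<in> S \<Longrightarrow> T (p i x) = 0"
  shows "T (partial_resolution p S x) = 0"
  by (rule has_sum_unique[OF partial_resolution_bounded_linear_has_sum[OF assms(1)] has_sum_0])
    (rule assms(2))

lemma partial_resolution_component:
  assumes "j \<in> I"
  shows "p j (partial_resolution p S x) = (if j \<in> S then p j x else 0)"
proof (rule has_sum_unique)
  show "((\<lambda>i. p j (p i x)) has_sum p j (partial_resolution p S x)) S"
    using assms by (intro partial_resolution_bounded_linear_has_sum orth_proj_bounded_linear
        orth_resolution_proj)
  show "((\<lambda>i. p j (p i x)) has_sum (if j \<in> S then p j x else 0)) S"
    using assms sub orth_resolution_orth[OF assms] orth_proj_idem[OF orth_resolution_proj[OF assms]]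
    by (intro has_sum_finite_neutralI[of "if j \<in> S then {j} else {}"]) (auto split: if_splits)
qed

lemma partial_resolution_selfadjoint:
  "inner (partial_resolution p S x) y = inner x (partial_resolution p S y)"
proof (rule has_sum_unique)
  show "((\<lambda>i. inner (p i x) y) has_sum inner (partial_resolution p S x) y) S"
    by (rule partial_resolution_bounded_linear_has_sum) (rule bounded_linear_inner_left)
  have "((\<lambda>i. inner x (p i y)) has_sum inner x (partial_resolution p S y)) S"
    by (rule partial_resolution_bounded_linear_has_sum) (rule bounded_linear_inner_right)
  then show "((\<lambda>i. inner (p i x) y) has_sum inner x (partial_resolution p S y)) S"
    using sub by (subst has_sum_cong[of _ _ "\<lambda>i. inner x (p i y)"])
      (auto simp: orth_proj_selfadjoint[OF orth_resolution_proj])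
qed

lemma partial_resolution_idem:
  "partial_resolution p S (partial_resolution p S x) = partial_resolution p S x"
  unfolding partial_resolution_def[of p S "partial_resolution p S x"]
  using sub by (subst partial_resolution_def[of p S x], intro infsum_cong)
    (auto simp: partial_resolution_component)

lemma partial_resolution_norm_has_sum:
  "((\<lambda>i. (norm (p i x))\<^sup>2) has_sum (norm (partial_resolution p S x))\<^sup>2) S"
proof -
  have "((\<lambda>i. inner x (p i x)) has_sum inner x (partial_resolution p S x)) S"
    by (rule partial_resolution_bounded_linear_has_sum) (rule bounded_linear_inner_right)
  moreover have "inner x (partial_resolution p S x) = (norm (partial_resolution p S x))\<^sup>2"
    by (metis partial_resolution_idem partial_resolution_selfadjoint power2_norm_eq_inner)
  ultimately show ?thesis
    using sub by (subst has_sum_cong[of _ _ "\<lambda>i. inner x (p i x)"])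
      (auto simp: orth_proj_norm_sq[OF orth_resolution_proj])
qed

text \<open>Linearity comes for free from self-adjointness, by testing against all vectors.
  Idempotence and Cauchy-Schwarz bound the norm by 1.\<close>

lemma orth_proj_partial_resolution: "orth_proj (partial_resolution p S)"
proof -
  have lin: "partial_resolution p S (x + y) = partial_resolution p S x + partial_resolution p S y"
    "partial_resolution p S (r *\<^sub>R x) = r *\<^sub>R partial_resolution p S x" for x y r
    by (rule vector_eq_rdot[THEN iffD1], rule allI; simp add: partial_resolution_selfadjoint inner_add_left)+
  have "norm (partial_resolution p S x) \<le> norm x * 1" for x
  proof -
    have "(norm (partial_resolution p S x))\<^sup>2 = inner x (partial_resolution p S x)"
      by (metis partial_resolution_idem partial_resolution_selfadjoint power2_norm_eq_inner)
    also have "\<dots> \<le> norm x * norm (partial_resolution p S x)"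
      by (rule norm_cauchy_schwarz)
    finally show ?thesis
      by (cases "partial_resolution p S x = 0") (auto simp: power2_eq_square)
  qed
  then have "bounded_linear (partial_resolution p S)"
    using lin by (intro bounded_linear_intro)
  then show ?thesis
    by (simp add: orth_proj_def partial_resolution_idem partial_resolution_selfadjoint)
qed

end

lemma orth_resolution_norm_has_sum:
  fixes p :: "'i \<Rightarrow> 'h \<Rightarrow> 'h::{real_inner,banach}"
  assumes "orth_resolution p I"
  shows "((\<lambda>i. (norm (p i x))\<^sup>2) has_sum (norm x)\<^sup>2) I"
proof -
  have "partial_resolution p I x = x"
    using orth_resolution_has_sum[OF assms order_refl]
    by (auto simp: partial_resolution_def intro: infsumI)
  then show ?thesis
    using partial_resolution_norm_has_sum[OF assms order_refl, of x] by simp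
qed

lemma partial_resolution_Compl:
  fixes p :: "'i \<Rightarrow> 'h \<Rightarrow> 'h::{real_inner,banach}"
  assumes "orth_resolution p I" "S \<subseteq> I"
  shows "x = partial_resolution p S x + partial_resolution p (I - S) x"
proof (rule has_sum_unique)
  show "((\<lambda>i. p i x) has_sum x) I"
    by (rule orth_resolution_has_sum[OF assms])
  show "((\<lambda>i. p i x) has_sum (partial_resolution p S x + partial_resolution p (I - S) x)) I"
    using has_sum_Un_disjoint[OF partial_resolution_has_sum[OF assms]
        partial_resolution_has_sum[OF assms(1), of "I - S"], of x] assms(2)
    by (auto simp: Un_absorb1)
qed

instance complex_hilbert_space \<subseteq> banach ..

lemma orth_resolution_if_projections_sum_to_one:
  "projections_sum_to_one p I \<Longrightarrow> orth_resolution p I"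
  unfolding projections_sum_to_one_def orth_resolution_def is_projection_def orth_proj_def
    bounded_clinear_def
  by (auto simp: fun_eq_iff inner_eq_Re_cinner)

subsection \<open>Edges through a point\<close>

lemma doubleton_in_J_vertices [simp]: "{b, c} \<in> J_vertices \<longleftrightarrow> b \<noteq> c"
  by (auto simp: J_vertices_def card_insert_if)

lemma J_verticesE:
  assumes "e \<in> J_vertices"
  obtains b c where "b \<noteq> c" "e = {b, c}"
  using assms by (auto simp: J_vertices_def card_2_iff)

lemma J_edges_sym: "(e, f) \<in> J_edges \<Longrightarrow> (f, e) \<in> J_edges"
  by (auto simp: J_edges_def Int_commute)

lemma J_edges_doubleton:
  assumes "a \<noteq> b" "c \<noteq> d"
  shows "({a, b}, {c, d}) \<in> J_edges \<longleftrightarrow> {a, b} \<noteq> {c, d} \<and> {a, b} \<inter> {c, d} \<noteq> {}"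
  using assms
  by (auto simp: J_edges_def doubleton_eq_iff Int_insert_left card_insert_if)

definition star :: "nat \<Rightarrow> nat set set"
  where "star a = {e \<in> J_vertices. a \<in> e}"

lemma star_subset: "star a \<subseteq> J_vertices"
  by (auto simp: star_def)

lemma starE:
  assumes "e \<in> star a"
  obtains b where "a \<noteq> b" "e = {a, b}"
proof -
  obtain b c where "b \<noteq> c" "e = {b, c}" "a = b \<or> a = c"
    using assms by (auto simp: star_def elim: J_verticesE)
  then show thesis
    using that[of b] that[of c] by (auto simp: insert_commute)
qed

lemma star_inter:
  assumes "a \<noteq> a'"
  shows "star a \<inter> star a' = {{a, a'}}"
  using assms by (auto simp: star_def elim!: J_verticesE)

text \<open>Two members of a star share \<open>a\<close>, so they are equal or adjacent, whereas
  disjoint vertices are distinct and non-adjacent.\<close>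

lemma star_rel_disjoint:
  assumes "e \<in> star a" "e' \<in> star a" "f \<in> J_vertices" "f' \<in> J_vertices" "f \<inter> f' = {}"
  shows "rel J_edges e e' \<noteq> rel J_edges f f'"
proof -
  obtain b b' where "a \<noteq> b" "e = {a, b}" "a \<noteq> b'" "e' = {a, b'}"
    using assms(1,2) by (metis starE)
  then have "rel J_edges e e' \<noteq> Nonadjacent_vertices"
    by (simp add: rel_def J_edges_doubleton)
  moreover have "f \<noteq> f'"
    using assms(3,5) by (auto simp: J_vertices_def)
  then have "rel J_edges f f' = Nonadjacent_vertices"
    using assms(5) by (simp add: rel_def J_edges_def)
  ultimately show ?thesis by simp
qed

text \<open>These two neighbours are the source of the factor 2 in
  \<open>P_norm_sum\<close>.\<close>

lemma star_neighbours:
  assumes "s \<noteq> t" "a \<notin> {s, t}"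
  shows "{e \<in> star a. ({s, t}, e) \<in> J_edges} = {{a, s}, {a, t}}"
proof (intro equalityI subsetI)
  fix e assume "e \<in> {e \<in> star a. ({s, t}, e) \<in> J_edges}"
  then obtain b where "a \<noteq> b" "e = {a, b}" "({s, t}, {a, b}) \<in> J_edges"
    by (auto elim: starE)
  then show "e \<in> {{a, s}, {a, t}}"
    using assms by (auto simp: J_edges_doubleton)
next
  fix e assume "e \<in> {{a, s}, {a, t}}"
  then show "e \<in> {e \<in> star a. ({s, t}, e) \<in> J_edges}"
    using assms by (auto simp: J_edges_doubleton star_def)
qed

lemma ex_nat_notin_set: "\<exists>k::nat. k \<notin> set xs"
  using ex_new_if_finite[OF infinite_UNIV_nat, of "set xs"] by auto

subsection \<open>The underlying quantum permutation\<close>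

locale johnson_quantum_automorphism =
  fixes u :: "nat set \<Rightarrow> nat set \<Rightarrow> 'h \<Rightarrow> 'h::{real_inner,banach}"
  assumes row: "e \<in> J_vertices \<Longrightarrow> orth_resolution (\<lambda>f. u e f) J_vertices"
    and column: "f \<in> J_vertices \<Longrightarrow> orth_resolution (\<lambda>e. u e f) J_vertices"
    and rel_zero: "\<lbrakk>e \<in> J_vertices; e' \<in> J_vertices; f \<in> J_vertices; f' \<in> J_vertices;
      rel J_edges e e' \<noteq> rel J_edges f f'\<rbrakk> \<Longrightarrow> u e f (u e' f' x) = 0"
begin

lemma orth_proj_u: "e \<in> J_vertices \<Longrightarrow> f \<in> J_vertices \<Longrightarrow> orth_proj (u e f)"
  using row by (auto simp: orth_resolution_def)

definition P :: "nat \<Rightarrow> nat set \<Rightarrow> 'h \<Rightarrow> 'h"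
  where "P a f = partial_resolution (\<lambda>e. u e f) (star a)"

lemma orth_proj_P: "f \<in> J_vertices \<Longrightarrow> orth_proj (P a f)"
  unfolding P_def by (rule orth_proj_partial_resolution[OF column star_subset])

lemma u_P_disjoint:
  assumes "e \<in> star a" "f \<in> J_vertices" "f' \<in> J_vertices" "f \<inter> f' = {}"
  shows "u e f (P a f' x) = 0"
  unfolding P_def
proof (rule partial_resolution_eq_zero[OF column star_subset])
  show "bounded_linear (u e f)"
    using assms star_subset by (intro orth_proj_bounded_linear orth_proj_u) auto
  fix e' assume "e' \<in> star a"
  then show "u e f (u e' f' x) = 0"
    using assms star_subset by (intro rel_zero star_rel_disjoint[of e a e' f f']) auto
qed (rule assms)

lemma P_P_disjoint:
  assumes "f \<in> J_vertices" "f' \<in> J_vertices" "f \<inter> f' = {}"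
  shows "P a f (P a f' x) = 0"
  using assms u_P_disjoint[OF _ assms]
  by (simp add: P_def[of a f] partial_resolution_def infsum_0)

text \<open>Both factors are partial sums of one column of orthogonal projections, so only the
  common member of the two stars survives.\<close>

lemma P_P_same_column:
  assumes "f \<in> J_vertices" "a \<noteq> a'"
  shows "P a f (P a' f x) = u {a, a'} f x"
proof -
  have "u e f (P a' f x) = (if e = {a, a'} then u {a, a'} f x else 0)" if "e \<in> star a" for e
  proof -
    have "e \<in> J_vertices" "e \<in> star a' \<longleftrightarrow> e = {a, a'}"
      using that star_inter[OF assms(2)] star_subset by blast+
    then show ?thesis
      using partial_resolution_component[OF column[OF assms(1)] star_subset, of e a' x]
      by (auto simp: P_def)
  qed
  then have "P a f (P a' f x) = (\<Sum>\<^sub>\<infinity>e\<in>star a. if e = {a, a'} then u {a, a'} f x else 0)"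
    unfolding P_def[of a f] partial_resolution_def by (rule infsum_cong)
  also have "\<dots> = u {a, a'} f x"
    using assms(2) by (intro infsumI has_sum_finite_neutralI[of "{{a, a'}}"]) (auto simp: star_def)
  finally show ?thesis .
qed

section \<open>The counting identity\<close>

text \<open>Let \<open>Q\<close> be the part of \<open>x\<close> carried in column
  \<open>{i, j}\<close> by the neighbours of \<open>e\<close>. Its squared norm is computed twice:
  along that column, giving the infinite sum, and along row \<open>e\<close>, where only four
  components survive.\<close>

lemma neighbour_norm_sum:
  assumes e: "e \<in> star a" and dist: "b \<noteq> c" "i \<noteq> j" "{b, c} \<inter> {i, j} = {}"
    and x: "P a {b, c} x = x"
  shows "((\<lambda>e'. (norm (u e' {i, j} x))\<^sup>2) has_sum
      (norm (u e {b, i} x))\<^sup>2 + (norm (u e {b, j} x))\<^sup>2 +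
      (norm (u e {c, i} x))\<^sup>2 + (norm (u e {c, j} x))\<^sup>2)
    {e' \<in> J_vertices. (e', e) \<in> J_edges}" (is "(_ has_sum ?s) ?N")
proof -
  define Q where "Q = partial_resolution (\<lambda>e'. u e' {i, j}) ?N x"
  define R where "R = partial_resolution (\<lambda>e'. u e' {i, j}) (J_vertices - ?N) x"
  have eV: "e \<in> J_vertices"
    using e star_subset by auto
  have gV: "{i, j} \<in> J_vertices"
    using dist by simp
  have NV: "?N \<subseteq> J_vertices"
    by auto
  have QR: "x = Q + R"
    unfolding Q_def R_def by (rule partial_resolution_Compl[OF column[OF gV] NV])
  \<comment> \<open>By \<open>rel_zero\<close>, \<open>u e f\<close> kills the remainder
    \<open>R\<close> if \<open>f\<close> is adjacent to \<open>{i, j}\<close>, and kills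
    \<open>Q\<close> otherwise.\<close>
  have uQ: "u e f Q = (if (f, {i, j}) \<in> J_edges then u e f x else 0)" if f: "f \<in> J_vertices" for f
  proof -
    have lin: "bounded_linear (u e f)"
      by (intro orth_proj_bounded_linear orth_proj_u eV f)
    show ?thesis
    proof (cases "(f, {i, j}) \<in> J_edges")
      case True
      have "u e f R = 0"
        unfolding R_def
      proof (rule partial_resolution_eq_zero[OF column[OF gV] _ lin])
        fix e' assume "e' \<in> J_vertices - ?N"
        then show "u e f (u e' {i, j} x) = 0"
          using True J_edges_sym[of e e'] f eV gV is_graph_J
          by (intro rel_zero) (auto simp: rel_def is_graph_def)
      qed auto
      then have "u e f x = u e f Q"
        using orth_proj_add[OF orth_proj_u[OF eV f], of Q R] QR by simp
      then show ?thesis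
        using True by simp
    next
      case False
      have "u e f Q = 0"
        unfolding Q_def
      proof (rule partial_resolution_eq_zero[OF column[OF gV] _ lin])
        fix e' assume "e' \<in> ?N"
        then show "u e f (u e' {i, j} x) = 0"
          using False J_edges_sym[of e' e] f eV gV is_graph_J
          by (intro rel_zero) (auto simp: rel_def is_graph_def)
      qed auto
      then show ?thesis
        using False by simp
    qed
  qed
  \<comment> \<open>A neighbour of \<open>{i, j}\<close> outside \<open>M\<close> is disjoint from
    \<open>{b, c}\<close>, so its component of \<open>x\<close> vanishes by
    \<open>u_P_disjoint\<close>.\<close>
  define M where "M = {{b, i}, {b, j}, {c, i}, {c, j}}"
  have MV: "M \<subseteq> J_vertices"
    using dist by (auto simp: M_def)
  have ME: "(f, {i, j}) \<in> J_edges" if "f \<in> M" for f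
    using that dist by (auto simp: M_def J_edges_doubleton)
  have "u e f Q = 0" if f: "f \<in> J_vertices - M" for f
  proof (cases "(f, {i, j}) \<in> J_edges")
    case True
    have "f \<in> J_vertices"
      using f by simp
    then obtain k l where kl: "k \<noteq> l" "f = {k, l}"
      by (rule J_verticesE)
    have "{k, l} \<noteq> {i, j}" "{k, l} \<inter> {i, j} \<noteq> {}"
      using True kl dist(2) by (simp_all add: J_edges_doubleton)
    then have "f \<inter> {b, c} = {}"
      using f kl dist by (auto simp: M_def doubleton_eq_iff)
    then have "u e f (P a {b, c} x) = 0"
      using e f dist by (intro u_P_disjoint) auto
    then show ?thesis
      using uQ f x by auto
  qed (use uQ f in auto)
  then have "((\<lambda>f. (norm (u e f Q))\<^sup>2) has_sum (\<Sum>f\<in>M. (norm (u e f Q))\<^sup>2)) J_vertices"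
    using MV by (intro has_sum_finite_neutralI[of M]) (auto simp: M_def)
  then have "(norm Q)\<^sup>2 = (\<Sum>f\<in>M. (norm (u e f Q))\<^sup>2)"
    using orth_resolution_norm_has_sum[OF row[OF eV]] by (rule has_sum_unique[rotated])
  also have "\<dots> = (\<Sum>f\<in>M. (norm (u e f x))\<^sup>2)"
    using uQ ME MV by (intro sum.cong) auto
  also have "\<dots> = ?s"
    using dist by (auto simp: M_def doubleton_eq_iff)
  finally show ?thesis
    using partial_resolution_norm_has_sum[OF column[OF gV] NV, of x] by (simp add: Q_def)
qed

text \<open>Double counting of adjacent pairs with \<open>e\<close> off the star and
  \<open>e'\<close> in it, weighted by \<open>g e\<close>. Each \<open>e\<close> has two partners
  and the weights total the squared norm of \<open>x\<close>; for fixed \<open>e'\<close> the sum is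
  \<open>neighbour_norm_sum\<close>.\<close>

lemma P_norm_sum:
  assumes dist: "b \<noteq> c" "i \<noteq> j" "{b, c} \<inter> {i, j} = {}"
    and x: "P a {b, c} x = x"
  shows "(norm (P a {b, i} x))\<^sup>2 + (norm (P a {b, j} x))\<^sup>2 +
      (norm (P a {c, i} x))\<^sup>2 + (norm (P a {c, j} x))\<^sup>2 = 2 * (norm x)\<^sup>2"
proof -
  define g where "g e = (norm (u e {i, j} x))\<^sup>2" for e
  define A where "A = J_vertices - star a"
  define B where "B e = {e' \<in> star a. (e, e') \<in> J_edges}" for e
  define s where "s e = (norm (u e {b, i} x))\<^sup>2 + (norm (u e {b, j} x))\<^sup>2 +
      (norm (u e {c, i} x))\<^sup>2 + (norm (u e {c, j} x))\<^sup>2" for e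
  have g0: "g e = 0" if "e \<in> star a" for e
  proof -
    have "u e {i, j} (P a {b, c} x) = 0"
      by (rule u_P_disjoint[OF that]) (use dist in auto)
    then show ?thesis
      by (simp add: g_def x)
  qed
  have cardB: "finite (B e) \<and> card (B e) = 2" if "e \<in> A" for e
  proof -
    have "e \<in> J_vertices"
      using that by (simp add: A_def)
    then obtain k l where kl: "k \<noteq> l" "e = {k, l}"
      by (rule J_verticesE)
    moreover have "a \<notin> {k, l}"
      using that kl by (auto simp: A_def star_def)
    ultimately have "B e = {{a, k}, {a, l}}"
      using star_neighbours[of k l a] by (simp add: B_def)
    then show ?thesis
      using kl by (auto simp: doubleton_eq_iff card_insert_if)
  qed
  have "(g has_sum (norm x)\<^sup>2) J_vertices"
    unfolding g_def using dist by (intro orth_resolution_norm_has_sum column) simp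
  also have "(g has_sum (norm x)\<^sup>2) J_vertices \<longleftrightarrow> (g has_sum (norm x)\<^sup>2) A"
    by (rule has_sum_cong_neutral) (auto simp: A_def g0)
  finally have gA: "((\<lambda>e. 2 * g e) has_sum 2 * (norm x)\<^sup>2) A"
    by (rule has_sum_cmult_right)
  have inner: "((\<lambda>e'. (\<lambda>(e, e'). g e) (e, e')) has_sum 2 * g e) (B e)" if "e \<in> A" for e
    using cardB[OF that] by (intro has_sum_finiteI) auto
  \<comment> \<open>Nonnegative terms: convergence of the iterated sum suffices, and the order of
    summation may then be exchanged.\<close>
  have "(\<lambda>(e, e'). g e) summable_on Sigma A B"
    by (rule summable_on_SigmaI[OF inner has_sum_imp_summable[OF gA]]) (auto simp: g_def)
  with inner gA have "((\<lambda>(e, e'). g e) has_sum 2 * (norm x)\<^sup>2) (Sigma A B)"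
    by (rule has_sum_SigmaI)
  also have "((\<lambda>(e, e'). g e) has_sum 2 * (norm x)\<^sup>2) (Sigma A B) \<longleftrightarrow>
      ((\<lambda>(e', e). g e) has_sum 2 * (norm x)\<^sup>2) (SIGMA e':star a. {e \<in> A. (e, e') \<in> J_edges})"
    by (rule has_sum_reindex_bij_witness[of _ prod.swap prod.swap]) (auto simp: B_def)
  finally have "(s has_sum 2 * (norm x)\<^sup>2) (star a)"
  proof (rule has_sum_SigmaD)
    fix e' assume e': "e' \<in> star a"
    have "(g has_sum s e') {e \<in> J_vertices. (e, e') \<in> J_edges}"
      unfolding g_def s_def by (rule neighbour_norm_sum[OF e' dist x])
    also have "(g has_sum s e') {e \<in> J_vertices. (e, e') \<in> J_edges} \<longleftrightarrow>
        (g has_sum s e') {e \<in> A. (e, e') \<in> J_edges}"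
      by (rule has_sum_cong_neutral) (auto simp: A_def g0)
    finally show "((\<lambda>e. (\<lambda>(e', e). g e) (e', e)) has_sum s e') {e \<in> A. (e, e') \<in> J_edges}"
      by simp
  qed
  moreover have "((\<lambda>e. (norm (u e f x))\<^sup>2) has_sum (norm (P a f x))\<^sup>2) (star a)"
    if "f \<in> J_vertices" for f
    unfolding P_def by (rule partial_resolution_norm_has_sum[OF column[OF that] star_subset])
  then have "(s has_sum (norm (P a {b, i} x))\<^sup>2 + (norm (P a {b, j} x))\<^sup>2 +
      (norm (P a {c, i} x))\<^sup>2 + (norm (P a {c, j} x))\<^sup>2) (star a)"
    unfolding s_def using dist by (intro has_sum_add) auto
  ultimately show ?thesis
    by (rule has_sum_unique[symmetric])
qed

section \<open>Splitting the range of \<open>P a {b, c}\<close>\<close>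

text \<open>The two summands are orthogonal components of \<open>x\<close>, so it suffices that
  their squared norms add up to at least that of \<open>x\<close>.\<close>

lemma P_decomposition:
  assumes "b \<noteq> c" "i \<noteq> j" "i \<notin> {b, c}" "j \<notin> {b, c}" and x: "P a {b, c} x = x"
  shows "x = P a {b, i} x + P a {c, j} x"
proof -
  define \<beta> where "\<beta> i = (norm (P a {b, i} x))\<^sup>2" for i
  define \<gamma> where "\<gamma> i = (norm (P a {c, i} x))\<^sup>2" for i
  have sum: "\<beta> k + \<beta> l + \<gamma> k + \<gamma> l = 2 * (norm x)\<^sup>2" if "k \<noteq> l" "k \<notin> {b, c}" "l \<notin> {b, c}" for k l
    unfolding \<beta>_def \<gamma>_def by (rule P_norm_sum) (use assms that in auto)
  have norm_diff: "(norm (x - (P a {b, k} x + P a {c, l} x)))\<^sup>2 = (norm x)\<^sup>2 - \<beta> k - \<gamma> l"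
    if "k \<noteq> l" "k \<notin> {b, c}" "l \<notin> {b, c}" for k l
  proof -
    have k: "orth_proj (P a {b, k})" and l: "orth_proj (P a {c, l})"
      using that by (auto intro: orth_proj_P)
    have "inner (P a {b, k} x) (P a {c, l} x) = inner x (P a {b, k} (P a {c, l} x))"
      by (rule orth_proj_selfadjoint[OF k])
    also have "P a {b, k} (P a {c, l} x) = 0"
      by (rule P_P_disjoint) (use assms that in auto)
    finally have "inner (P a {b, k} x) (P a {c, l} x) = 0"
      by simp
    then show ?thesis
      using orth_proj_norm_sq[OF k, of x] orth_proj_norm_sq[OF l, of x]
      unfolding \<beta>_def \<gamma>_def power2_norm_eq_inner
      by (simp add: inner_diff_left inner_diff_right inner_add_left inner_add_right inner_commute)
  qed
  \<comment> \<open>With a third point, the three pairwise sums from \<open>P_norm_sum\<close>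
    determine each \<beta> + \<gamma> separately.\<close>
  obtain k where "k \<notin> {b, c, i, j}"
    using ex_nat_notin_set[of "[b, c, i, j]"] by auto
  then have "\<beta> i + \<gamma> i = (norm x)\<^sup>2" "\<beta> j + \<gamma> j = (norm x)\<^sup>2"
    using sum[of i j] sum[of i k] sum[of j k] assms by auto
  \<comment> \<open>Bessel's inequality for the swapped pair bounds \<beta> j + \<gamma> i above,
    hence \<beta> i + \<gamma> j below.\<close>
  moreover have "0 \<le> (norm x)\<^sup>2 - \<beta> j - \<gamma> i"
    using assms by (subst norm_diff[symmetric]) auto
  ultimately have "(norm (x - (P a {b, i} x + P a {c, j} x)))\<^sup>2 \<le> 0"
    using norm_diff[of i j] assms by auto
  then show ?thesis
    by simp
qed

text \<open>Two splittings of the same vector share the summand for \<open>{c, k}\<close>, which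
  cancels.\<close>

lemma P_P_indep:
  assumes "b \<noteq> c" "i \<notin> {b, c}" "j \<notin> {b, c}"
  shows "P a {b, i} (P a {b, c} x) = P a {b, j} (P a {b, c} x)"
proof -
  obtain k where "k \<notin> {b, c, i, j}"
    using ex_nat_notin_set[of "[b, c, i, j]"] by auto
  moreover have "P a {b, c} (P a {b, c} x) = P a {b, c} x"
    using assms by (intro orth_proj_idem orth_proj_P) simp
  ultimately have "P a {b, i} (P a {b, c} x) + P a {c, k} (P a {b, c} x) = P a {b, c} x"
    "P a {b, j} (P a {b, c} x) + P a {c, k} (P a {b, c} x) = P a {b, c} x"
    using assms by (auto intro!: P_decomposition[symmetric])
  then show ?thesis
    by (metis add_right_cancel)
qed

text \<open>A product of two such projections also lies in the range of \<open>P a {b, k}\<close>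
  for a fresh \<open>k\<close>. There \<open>P a {b, i}\<close> and \<open>P a {b, j}\<close> agree,
  so the product is fixed by both.\<close>

lemma P_P_commute:
  assumes "i \<noteq> j" "i \<noteq> b" "j \<noteq> b"
  shows "P a {b, i} (P a {b, j} x) = P a {b, j} (P a {b, i} x)"
proof (rule orth_proj_commute)
  show "orth_proj (P a {b, i})" "orth_proj (P a {b, j})"
    using assms by (auto intro: orth_proj_P)
  fix x
  obtain k where k: "k \<notin> {b, i, j}"
    using ex_nat_notin_set[of "[b, i, j]"] by auto
  define y where "y = P a {b, i} (P a {b, j} x)"
  have y: "y = P a {b, k} (P a {b, j} x)"
    unfolding y_def using assms k by (intro P_P_indep) auto
  have "P a {b, j} y = P a {b, i} y"
    unfolding y using assms k by (intro P_P_indep) auto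
  also have "\<dots> = y"
    unfolding y_def using assms by (intro orth_proj_idem orth_proj_P) auto
  finally show "P a {b, i} (P a {b, j} x) = P a {b, j} (P a {b, i} (P a {b, j} x))"
    by (simp add: y_def)
qed

section \<open>The quantum permutation \<open>C\<close>\<close>

text \<open>The two successors merely supply distinct points other than \<open>b\<close>;
  \<open>C_eq\<close> removes the choice.\<close>

definition C :: "nat \<Rightarrow> nat \<Rightarrow> 'h \<Rightarrow> 'h"
  where "C a b x = P a {b, Suc b} (P a {b, Suc (Suc b)} x)"

text \<open>A fresh \<open>k\<close> links both pairs: move it into the right factor by independence
  and commutation, then change the left factor.\<close>

lemma C_eq:
  assumes "i \<noteq> j" "i \<noteq> b" "j \<noteq> b"
  shows "C a b x = P a {b, i} (P a {b, j} x)"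
proof -
  obtain k where k: "k \<notin> {b, i, j, Suc b, Suc (Suc b)}"
    using ex_nat_notin_set[of "[b, i, j, Suc b, Suc (Suc b)]"] by auto
  have to_k: "P a {b, s} (P a {b, t} x) = P a {b, t} (P a {b, k} x)"
    if "s \<noteq> t" "s \<noteq> b" "t \<noteq> b" "k \<notin> {s, t}" for s t
    using P_P_indep[of b t s k a x] P_P_commute[of k t b a x] that k by auto
  have "C a b x = P a {b, Suc (Suc b)} (P a {b, k} x)"
    unfolding C_def using k by (intro to_k) auto
  also have "\<dots> = P a {b, j} (P a {b, k} x)"
    using k assms by (intro P_P_indep) auto
  also have "\<dots> = P a {b, i} (P a {b, j} x)"
    using k assms by (intro to_k[symmetric]) auto
  finally show ?thesis .
qed

lemma P_eq_C_plus_C: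
  assumes "b \<noteq> c"
  shows "P a {b, c} x = C a b x + C a c x"
proof -
  obtain i where i: "i \<notin> {b, c}"
    using ex_nat_notin_set[of "[b, c]"] by auto
  obtain j where j: "j \<notin> {b, c, i}"
    using ex_nat_notin_set[of "[b, c, i]"] by auto
  have "P a {b, c} (P a {b, c} x) = P a {b, c} x"
    using assms by (intro orth_proj_idem orth_proj_P) simp
  then have "P a {b, c} x = P a {b, i} (P a {b, c} x) + P a {c, j} (P a {b, c} x)"
    using assms i j by (intro P_decomposition) auto
  also have "P a {b, i} (P a {b, c} x) = C a b x"
    using assms i j by (intro C_eq[symmetric]) auto
  also have "P a {c, j} (P a {b, c} x) = C a c x"
    using assms i j C_eq[of j b c a x] by (auto simp: insert_commute)
  finally show ?thesis .
qed

text \<open>The free points are chosen so that the two middle factors belong to the disjoint sets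
  \<open>{b, j}\<close> and \<open>{c, k}\<close>.\<close>

lemma C_C_orth:
  assumes "b \<noteq> c"
  shows "C a b (C a c x) = 0"
proof -
  obtain i where i: "i \<notin> {b, c}"
    using ex_nat_notin_set[of "[b, c]"] by auto
  obtain j where j: "j \<notin> {b, c, i}"
    using ex_nat_notin_set[of "[b, c, i]"] by auto
  obtain k where k: "k \<notin> {b, c, i, j}"
    using ex_nat_notin_set[of "[b, c, i, j]"] by auto
  have "C a b (C a c x) = P a {b, i} (P a {b, j} (P a {c, k} (P a {c, i} x)))"
    using i j k by (subst C_eq[of i j], simp_all, subst C_eq[of k i], simp_all)
  also have "P a {b, j} (P a {c, k} (P a {c, i} x)) = 0"
    using assms i j k by (intro P_P_disjoint) auto
  also have "P a {b, i} 0 = 0"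
    using i by (intro orth_proj_zero orth_proj_P) auto
  finally show ?thesis .
qed

lemma C_P_absorb:
  assumes "j \<noteq> b"
  shows "C a b (P a {b, j} x) = C a b x" "P a {b, j} (C a b x) = C a b x"
proof -
  obtain i where i: "i \<notin> {b, j}"
    using ex_nat_notin_set[of "[b, j]"] by auto
  have idem: "P a {b, j} (P a {b, j} y) = P a {b, j} y" for y
    using assms by (intro orth_proj_idem orth_proj_P) auto
  show "C a b (P a {b, j} x) = C a b x"
    using assms i by (simp add: C_eq[of i j] idem)
  show "P a {b, j} (C a b x) = C a b x"
    using assms i by (simp add: C_eq[of j i] idem)
qed

lemma orth_proj_C: "orth_proj (C a b)"
proof -
  have P: "orth_proj (P a {b, Suc b})" "orth_proj (P a {b, Suc (Suc b)})"
    by (auto intro: orth_proj_P)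
  have "C a b = (\<lambda>x. P a {b, Suc b} (P a {b, Suc (Suc b)} x))"
    by (simp add: C_def fun_eq_iff)
  then have "bounded_linear (C a b)"
    using bounded_linear_compose[OF P[THEN orth_proj_bounded_linear]] by simp
  moreover have "C a b (C a b x) = C a b x" for x
    by (subst C_def) (simp add: C_P_absorb(2))
  moreover have "inner (C a b x) y = inner x (C a b y)" for x y
    using P_P_commute[of "Suc b" "Suc (Suc b)" b a y]
    by (simp add: C_def orth_proj_selfadjoint[OF P(1)] orth_proj_selfadjoint[OF P(2)])
  ultimately show ?thesis
    by (simp add: orth_proj_def)
qed

text \<open>
  For every \<open>j\<close> the product \<open>C a b (C a' b x)\<close> factors through \<open>u {a, a'} {b, j}\<close>, and the squared
  norms of these infinitely many components of one vector are summable.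
\<close>

lemma C_C_same_column:
  assumes "a \<noteq> a'"
  shows "C a b (C a' b x) = 0"
proof (rule ccontr)
  define y where "y = C a' b x"
  define \<epsilon> where "\<epsilon> = (norm (C a b y))\<^sup>2"
  assume "C a b (C a' b x) \<noteq> 0"
  then have "\<epsilon> > 0"
    by (simp add: \<epsilon>_def y_def)
  have le: "\<epsilon> \<le> (norm (u {a, a'} {b, j} y))\<^sup>2" if "j \<noteq> b" for j
  proof -
    have "C a b y = C a b (P a {b, j} (P a' {b, j} y))"
      using that by (simp add: C_P_absorb y_def)
    also have "\<dots> = C a b (u {a, a'} {b, j} y)"
      using that assms by (simp add: P_P_same_column)
    finally show ?thesis
      using orth_proj_norm_le[OF orth_proj_C] by (simp add: \<epsilon>_def power_mono)
  qed
  obtain n :: nat where n: "(norm y)\<^sup>2 < real n * \<epsilon>"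
    using reals_Archimedean3[OF \<open>\<epsilon> > 0\<close>] by blast
  \<comment> \<open>Starting at \<open>Suc b\<close> avoids \<open>b\<close> and yields
    \<open>n\<close> distinct columns, each carrying at least \<epsilon>.\<close>
  define F where "F = (\<lambda>j. {b, Suc b + j}) ` {..<n}"
  have "inj_on (\<lambda>j. {b, Suc b + j}) {..<n}"
    by (auto simp: inj_on_def doubleton_eq_iff)
  then have "real n * \<epsilon> = real (card F) * \<epsilon>"
    by (simp add: F_def card_image)
  also have "\<dots> \<le> (\<Sum>f\<in>F. (norm (u {a, a'} f y))\<^sup>2)"
    by (rule sum_bounded_below) (auto simp: F_def intro: le)
  also have "\<dots> \<le> (norm y)\<^sup>2"
    using assms by (intro finite_sum_le_has_sum[OF orth_resolution_norm_has_sum[OF row]])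
      (auto simp: F_def)
  finally show False
    using n by simp
qed

section \<open>Commutation of the entries\<close>

text \<open>Expand the product of \<open>C a b + C a b'\<close> and \<open>C a' b + C a' b'\<close>;
  the two same-column terms vanish.\<close>

lemma u_eq_C:
  assumes "a \<noteq> a'" "b \<noteq> b'"
  shows "u {a, a'} {b, b'} x = C a b (C a' b' x) + C a b' (C a' b x)"
proof -
  have "u {a, a'} {b, b'} x = P a {b, b'} (P a' {b, b'} x)"
    using assms by (simp add: P_P_same_column)
  then show ?thesis
    using assms by (simp add: P_eq_C_plus_C orth_proj_add[OF orth_proj_C] C_C_same_column)
qed

text \<open>Equate the expansions of \<open>u {a, a'} {b, b'}\<close> and
  \<open>u {a', a} {b, b'}\<close> on the range of \<open>C a' b'\<close>. The mixed terms die by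
  row and column orthogonality, leaving the hypothesis of \<open>orth_proj_commute\<close>.\<close>

lemma C_commute: "C a b (C a' b' x) = C a' b' (C a b x)"
proof (cases "a = a' \<or> b = b'")
  case True
  then show ?thesis
    by (metis C_C_orth C_C_same_column)
next
  case False
  show ?thesis
  proof (rule orth_proj_commute[OF orth_proj_C orth_proj_C])
    fix x
    have "C a b (C a' b' (C a' b' x)) + C a b' (C a' b (C a' b' x)) =
        C a' b (C a b' (C a' b' x)) + C a' b' (C a b (C a' b' x))"
      using u_eq_C[of a a' b b' "C a' b' x"] u_eq_C[of a' a b b' "C a' b' x"] False
      by (simp add: insert_commute)
    then show "C a b (C a' b' x) = C a' b' (C a b (C a' b' x))"
      using False by (simp add: orth_proj_idem[OF orth_proj_C] orth_proj_zero[OF orth_proj_C]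
          C_C_orth C_C_same_column)
  qed
qed

lemma u_commute:
  assumes "e \<in> J_vertices" "f \<in> J_vertices" "e' \<in> J_vertices" "f' \<in> J_vertices"
  shows "u e f (u e' f' x) = u e' f' (u e f x)"
proof -
  obtain a b c d a' b' c' d' where "a \<noteq> b" "e = {a, b}" "c \<noteq> d" "f = {c, d}"
    "a' \<noteq> b'" "e' = {a', b'}" "c' \<noteq> d'" "f' = {c', d'}"
    using assms by (metis J_verticesE)
  moreover have "C a b (u {a', b'} {c', d'} x) = u {a', b'} {c', d'} (C a b x)"
    if "a' \<noteq> b'" "c' \<noteq> d'" for a b a' b' c' d' x
    using that by (simp add: u_eq_C orth_proj_add[OF orth_proj_C] C_commute[of a b])
  ultimately show ?thesis
    by (simp add: u_eq_C[of a b] orth_proj_add[OF orth_proj_u])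
qed

end

subsection \<open>Scalar commutant\<close>

lemma cinner_add_right: "cinner x (y + z) = cinner x y + cinner x z"
  by (metis cinner_add_left cinner_commute complex_cnj_add)

lemma cinner_scaleC_right: "cinner x (c *\<^sub>C y) = c * cinner x y"
  by (metis cinner_scaleC_left cinner_commute complex_cnj_cnj complex_cnj_mult)

lemma norm_scaleC: "norm (c *\<^sub>C x) = cmod c * norm x"
proof -
  have "cinner (c *\<^sub>C x) (c *\<^sub>C x) = c * cnj c * cinner x x"
    by (simp add: cinner_scaleC_left cinner_scaleC_right)
  then have "complex_of_real ((norm (c *\<^sub>C x))\<^sup>2) = complex_of_real ((cmod c * norm x)\<^sup>2)"
    by (simp only: cinner_self_eq_norm complex_norm_square[symmetric] of_real_mult
        power_mult_distrib of_real_power)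
  then show ?thesis
    by (simp only: of_real_eq_iff) (simp add: power2_eq_iff_nonneg)
qed

text \<open>The crude factor 2 comes from bounding real and imaginary parts separately by the real
  Cauchy-Schwarz inequality; boundedness needs no more.\<close>

lemma norm_cinner_le: "cmod (cinner x y) \<le> 2 * norm x * norm y"
proof -
  have "inner (\<i> *\<^sub>C x) y = Im (cinner x y)"
    by (simp add: inner_eq_Re_cinner cinner_scaleC_left)
  then have "\<bar>Im (cinner x y)\<bar> \<le> norm x * norm y"
    using Cauchy_Schwarz_ineq2[of "\<i> *\<^sub>C x" y] by (simp add: norm_scaleC)
  moreover have "\<bar>Re (cinner x y)\<bar> \<le> norm x * norm y"
    using Cauchy_Schwarz_ineq2[of x y] by (simp add: inner_eq_Re_cinner)
  ultimately show ?thesis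
    using cmod_le[of "cinner x y"] by linarith
qed

lemma bounded_clinear_rank_one: "bounded_clinear (\<lambda>y. cinner x y *\<^sub>C x)"
proof -
  have "norm (cinner x y *\<^sub>C x) \<le> norm y * (2 * norm x * norm x)" for y
    using mult_right_mono[OF norm_cinner_le[of x y] norm_ge_zero[of x]]
    by (simp add: norm_scaleC mult_ac)
  then have "bounded_linear (\<lambda>y. cinner x y *\<^sub>C x)"
    by (intro bounded_linear_intro)
      (simp_all add: cinner_add_right scaleC_add_left scaleR_scaleC cinner_scaleC_right
        scaleC_scaleC)
  then show ?thesis
    by (simp add: bounded_clinear_def cinner_scaleC_right scaleC_scaleC)
qed

text \<open>The rank-one operator built from \<open>x\<close> has range in the line through
  \<open>x\<close>; being a nonzero scalar, it also maps onto the whole space.\<close>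

lemma cdim_one_if_scalars:
  assumes nonzero: "x \<noteq> (0 :: 'h::complex_hilbert_space)"
    and scalar: "\<And>T :: 'h \<Rightarrow> 'h. bounded_clinear T \<Longrightarrow> \<exists>c. T = (\<lambda>x. c *\<^sub>C x)"
  shows "cdim (UNIV :: 'h set) = 1"
proof -
  obtain c where c: "cinner x y *\<^sub>C x = c *\<^sub>C y" for y
    using scalar[OF bounded_clinear_rank_one[of x]] by (metis (no_types))
  have "c \<noteq> 0"
    using c[of x] nonzero by (auto simp: cinner_self_eq_norm)
  have "y \<in> complex_vector.span {x}" for y
  proof -
    have "y = (inverse c * cinner x y) *\<^sub>C x"
      using arg_cong[OF c[of y], of "\<lambda>z. inverse c *\<^sub>C z"] \<open>c \<noteq> 0\<close> by (simp add: scaleC_scaleC)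
    then show ?thesis
      by (metis complex_vector.span_base complex_vector.span_scale singletonI)
  qed
  then show ?thesis
    using nonzero complex_vector.dim_eq_card[of "{x}" UNIV] by auto
qed

theorem proposition7p6:
  shows "no_quantum_symmetry TYPE('h::complex_hilbert_space) J_vertices J_edges"
  unfolding no_quantum_symmetry_def
proof (intro allI impI, elim conjE)
  fix u :: "nat set \<Rightarrow> nat set \<Rightarrow> 'h \<Rightarrow> 'h"
  assume qa: "quantum_automorphism J_vertices J_edges u"
    and irr: "irreducible_family J_vertices u"
  interpret johnson_quantum_automorphism u
  proof
    show "orth_resolution (\<lambda>f. u e f) J_vertices" if "e \<in> J_vertices" for e
      using qa that by (intro orth_resolution_if_projections_sum_to_one)
        (simp add: quantum_automorphism_def)
    show "orth_resolution (\<lambda>e. u e f) J_vertices" if "f \<in> J_vertices" for f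
      using qa that by (intro orth_resolution_if_projections_sum_to_one)
        (simp add: quantum_automorphism_def)
    show "u e f (u e' f' x) = 0"
      if "e \<in> J_vertices" "e' \<in> J_vertices" "f \<in> J_vertices" "f' \<in> J_vertices"
        "rel J_edges e e' \<noteq> rel J_edges f f'" for e e' f f' x
    proof -
      have "u e f \<circ> u e' f' = (\<lambda>_. 0)"
        using qa that unfolding quantum_automorphism_def by blast
      then show ?thesis
        by (simp add: fun_eq_iff)
    qed
  qed
  have clinear: "bounded_clinear (u e f)" if "e \<in> J_vertices" "f \<in> J_vertices" for e f
    using qa that
    by (auto simp: quantum_automorphism_def projections_sum_to_one_def is_projection_def)
  have commutant: "\<exists>c. T = (\<lambda>x. c *\<^sub>C x)"
    if "bounded_clinear T" "\<And>e f x. e \<in> J_vertices \<Longrightarrow> f \<in> J_vertices \<Longrightarrow> T (u e f x) = u e f (T x)"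
    for T
  proof -
    have "\<forall>e\<in>J_vertices. \<forall>f\<in>J_vertices. T \<circ> u e f = u e f \<circ> T"
      using that(2) by (simp add: fun_eq_iff)
    then show ?thesis
      using irr that(1) unfolding irreducible_family_def by blast
  qed
  \<comment> \<open>The entries commute with each other, so irreducibility applies to each of
    them.\<close>
  have u_scalar: "\<exists>c. u e f = (\<lambda>x. c *\<^sub>C x)" if "e \<in> J_vertices" "f \<in> J_vertices" for e f
    using that by (intro commutant clinear u_commute)
  \<comment> \<open>Scalar entries commute with every bounded operator, so the commutant is
    everything and irreducibility applies again.\<close>
  have "\<exists>c. T = (\<lambda>x. c *\<^sub>C x)" if T: "bounded_clinear T" for T :: "'h \<Rightarrow> 'h"
  proof (rule commutant[OF T])
    fix e f x assume "e \<in> J_vertices" "f \<in> J_vertices"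
    then obtain c where "u e f = (\<lambda>x. c *\<^sub>C x)"
      using u_scalar by blast
    then show "T (u e f x) = u e f (T x)"
      using T by (simp add: bounded_clinear_def)
  qed
  moreover obtain x :: 'h where "x \<noteq> 0"
    using irr by (auto simp: irreducible_family_def)
  ultimately show "cdim (UNIV :: 'h set) = 1"
    by (intro cdim_one_if_scalars)
qed

end
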